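(* (Extension Theorem) Let $M$ be a Pincherle realiser and let $e_0$ be a Kleene index for the partially computable functional $\Phi$ given by $\Phi(F)=\{e_0\}(F,\mu)$ (with $F$ of type $2$). Then, uniformly in $M$, $\Phi$ has a total extension (depending on $M$) that is primitive recursive in $M$ and $\mu$.
   Context: $C=2^{\mathbb N}$; for $f\in C$, $\overline{f}n=\langle f(0),\dots,f(n-1)\rangle$ and $[\sigma]$ is the set of $g\in C$ extending $\sigma$. For $F,G:C\to\mathbb N$, $\mathsf{LOC}(F,G)$ means $(\forall f,g\in C)\big(g\in[\overline{f}G(f)]\to F(g)\le G(f)\big)$. A Pincherle realiser is a functional $M$ assigning natural numbers to functionals $G:C\to\mathbb N$ such that $(\forall F,G)\big(\mathsf{LOC}(F,G)\to(\forall g\in C)(F(g)\le M(G))\big)$. $\mu$ is Feferman's functional: $\mu(f)$ is the least $n$ with $f(n)=0$ if such $n$ exists, and $0$ otherwise. $\{e\}(\cdot)$ denotes Kleene computation with index $e$ in the sense of the schemes S1–S9; primitive recursion is in the sense of higher-type (Kleene) computability. *)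

theory Defs
  imports Main "HOL-Library.Nat_Bijection"
begin

datatype val =
    V0 nat
  | V1 "nat \<Rightarrow> nat"
  | V2 "(nat \<Rightarrow> nat) \<Rightarrow> nat"
  | V3 "((nat \<Rightarrow> nat) \<Rightarrow> nat) \<Rightarrow> nat"

definition cantor :: "(nat \<Rightarrow> nat) set" where
  "cantor = {f. \<forall>n. f n \<le> 1}"

definition ext_seg :: "(nat \<Rightarrow> nat) \<Rightarrow> nat \<Rightarrow> (nat \<Rightarrow> nat) \<Rightarrow> bool" where
  "ext_seg f n g \<longleftrightarrow> (\<forall>i<n. g i = f i)"

definition LOC :: "((nat \<Rightarrow> nat) \<Rightarrow> nat) \<Rightarrow> ((nat \<Rightarrow> nat) \<Rightarrow> nat) \<Rightarrow> bool" where
  "LOC F G \<longleftrightarrow> (\<forall>f\<in>cantor. \<forall>g\<in>cantor. ext_seg f (G f) g \<longrightarrow> F g \<le> G f)"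

definition pincherle_realiser :: "(((nat \<Rightarrow> nat) \<Rightarrow> nat) \<Rightarrow> nat) \<Rightarrow> bool" where
  "pincherle_realiser M \<longleftrightarrow> (\<forall>F G. LOC F G \<longrightarrow> (\<forall>g\<in>cantor. F g \<le> M G))"

definition feferman_mu :: "(nat \<Rightarrow> nat) \<Rightarrow> nat" where
  "feferman_mu f = (if \<exists>n. f n = 0 then (LEAST n. f n = 0) else 0)"

text \<open>Indices are natural numbers; an index is the code (via list_encode) of a list
  whose head is the scheme number. The flag s9 says whether scheme S9 may be used;
  with s9 = False we get exactly the (higher-type) primitive recursive computations
  (schemes S1--S8).  S6 is realised by transpositions of adjacent arguments.\<close>

inductive kleene :: "bool \<Rightarrow> nat \<Rightarrow> val list \<Rightarrow> nat \<Rightarrow> bool" for s9 :: bool where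
  S1: "kleene s9 (list_encode [1]) (V0 x # as) (Suc x)"
| S2: "kleene s9 (list_encode [2, q]) as q"
| S3: "kleene s9 (list_encode [3]) (V0 x # as) x"
| S4: "\<lbrakk>kleene s9 e2 as m; kleene s9 e1 (V0 m # as) n\<rbrakk>
       \<Longrightarrow> kleene s9 (list_encode [4, e1, e2]) as n"
| S5_0: "kleene s9 e1 as n \<Longrightarrow> kleene s9 (list_encode [5, e1, e2]) (V0 0 # as) n"
| S5_Suc: "\<lbrakk>kleene s9 (list_encode [5, e1, e2]) (V0 x # as) m;
           kleene s9 e2 (V0 m # V0 x # as) n\<rbrakk>
       \<Longrightarrow> kleene s9 (list_encode [5, e1, e2]) (V0 (Suc x) # as) n"
| S6: "\<lbrakk>Suc i < length as; kleene s9 e ((as[i := as ! Suc i])[Suc i := as ! i]) n\<rbrakk>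
       \<Longrightarrow> kleene s9 (list_encode [6, e, i]) as n"
| S7: "kleene s9 (list_encode [7]) (V0 x # V1 f # as) (f x)"
| S8_2: "(\<forall>x. kleene s9 e1 (V0 x # V2 F # as) (g x))
       \<Longrightarrow> kleene s9 (list_encode [8, e1]) (V2 F # as) (F g)"
| S8_3: "(\<forall>f. kleene s9 e1 (V1 f # V3 M # as) (G f))
       \<Longrightarrow> kleene s9 (list_encode [8, e1]) (V3 M # as) (M G)"
| S9: "\<lbrakk>s9; m \<le> length as; kleene s9 e (take m as) n\<rbrakk>
       \<Longrightarrow> kleene s9 (list_encode [9, m]) (V0 e # as) n"

abbreviation kleene_comp :: "nat \<Rightarrow> val list \<Rightarrow> nat \<Rightarrow> bool" where
  "kleene_comp \<equiv> kleene True"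

abbreviation prim_rec_comp :: "nat \<Rightarrow> val list \<Rightarrow> nat \<Rightarrow> bool" where
  "prim_rec_comp \<equiv> kleene False"

end

theory Submission
  imports Defs
begin

text \<open>
  Fix F and let \<open>g\<close> be the graph of all terminating computations from F, \<open>\<mu>\<close> and numbers. A point f of
  Cantor space is read as a guess of this graph. The computations that f regards as hereditary
  subcomputations of \<open>e\<^sub>0\<close> form a tree arithmetical in f and F, and whether f is locally correct on
  that tree is arithmetical as well. Suppose that \<open>e\<^sub>0\<close> terminates with value n. A guess that is correct on its tree
  has the true value at \<open>e\<^sub>0\<close>. For any other guess, always descending to the leftmost subcomputation with an
  error below it ends, because the true tree is well-founded, at a true subcomputation where all
  subcomputations have their true values but f violates the local clause; this yields a neighbourhood of f,
  found arithmetically, that does not contain \<open>g\<close>.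

  Let \<open>G\<^sub>k\<^sub>,\<^sub>j(f)\<close> be such a neighbourhood length for incorrect f, and for correct f let it be j if f gives
  \<open>e\<^sub>0\<close> the value k and 0 otherwise. The functional that is j at \<open>g\<close> and 0 elsewhere is localised by
  \<open>G\<^sub>n\<^sub>,\<^sub>j\<close>, so \<open>j \<le> M(G\<^sub>n\<^sub>,\<^sub>j)\<close>, whereas for \<open>k \<noteq> n\<close> the functional \<open>G\<^sub>k\<^sub>,\<^sub>j\<close> does not depend on j. Hence n is
  the only k such that \<open>M(G\<^sub>k\<^sub>,\<^sub>j) \<noteq> M(G\<^sub>k\<^sub>,\<^sub>0)\<close> for some j, and \<open>\<mu>\<close> finds it.
\<close>

section \<open>Functionals primitive recursive in the environment\<close>

declare list_encode.simps [simp del] list_encode_eq [simp]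

text \<open>Each scheme acts on an initial part of the list and hands the rest on, so surplus
  arguments at the end do no harm.\<close>

lemma kleene_append:
  assumes "kleene False e as n"
  shows "kleene False e (as @ bs) n"
  using assms
proof induction
  case (S6 i as e n)
  from S6 show ?case
    by (intro kleene.S6) (auto simp: nth_append list_update_append)
qed (auto intro: kleene.intros kleene.S1[unfolded One_nat_def])

text \<open>S6 swaps neighbours only; swapping positions \<open>i\<close> and \<open>Suc i\<close>
  first reduces the task to \<open>i\<close>. The index found serves every list.\<close>

lemma kleene_move_to_front:
  "\<exists>e'. \<forall>as n. i < length as \<longrightarrow> kleene False e (as ! i # take i as @ drop (Suc i) as) n \<longrightarrow>
     kleene False e' as n"
proof (induction i)
  case 0
  have "as ! 0 # take 0 as @ drop (Suc 0) as = as" if "0 < length as" for as :: "val list"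
    using that by (cases as) auto
  then show ?case by metis
next
  case (Suc i)
  then obtain e' where e': "\<And>as n. i < length as \<Longrightarrow>
     kleene False e (as ! i # take i as @ drop (Suc i) as) n \<Longrightarrow> kleene False e' as n"
    by blast
  have "kleene False (list_encode [6, e', i]) as n"
    if l: "Suc i < length as" and k: "kleene False e (as ! Suc i # take (Suc i) as @ drop (Suc (Suc i)) as) n"
    for as n
  proof (rule kleene.S6[OF l], rule e')
    let ?b = "(as[i := as ! Suc i])[Suc i := as ! i]"
    show "i < length ?b" using l by simp
    have "drop (Suc i) ?b = as ! i # drop (Suc (Suc i)) as"
      using l by (simp add: Cons_nth_drop_Suc[symmetric, of "Suc i" as] drop_update_swap)
    then have "?b ! i # take i ?b @ drop (Suc i) ?b =
        as ! Suc i # take (Suc i) as @ drop (Suc (Suc i)) as"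
      using l by (simp add: take_Suc_conv_app_nth)
    with k show "kleene False e (?b ! i # take i ?b @ drop (Suc i) ?b) n" by simp
  qed
  then show ?case by blast
qed

text \<open>The inverse rearrangement. If \<open>i\<close> is the length of the list, it moves the
  head to the end, where \<open>kleene_append\<close> can discard it.\<close>

lemma kleene_move_from_front:
  "\<exists>e'. \<forall>x as n. i \<le> length as \<longrightarrow> kleene False e (take i as @ x # drop i as) n \<longrightarrow>
     kleene False e' (x # as) n"
proof (induction i arbitrary: e)
  case 0
  then show ?case by auto
next
  case (Suc i)
  obtain e' where e': "\<And>x as n. i \<le> length as \<Longrightarrow>
     kleene False (list_encode [6, e, i]) (take i as @ x # drop i as) n \<Longrightarrow>
     kleene False e' (x # as) n"
    using Suc by blast
  have "kleene False e' (x # as) n"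
    if l: "Suc i \<le> length as" and k: "kleene False e (take (Suc i) as @ x # drop (Suc i) as) n"
    for x as n
  proof (rule e')
    show "i \<le> length as" using l by simp
    have d: "drop i as = as ! i # drop (Suc i) as"
      using l by (simp add: Cons_nth_drop_Suc)
    show "kleene False (list_encode [6, e, i]) (take i as @ x # drop i as) n"
      using l k by (intro kleene.S6)
        (auto simp: d nth_append list_update_append take_Suc_conv_app_nth)
  qed
  then show ?case by blast
qed

text \<open>An environment maps parameters p to the argument list of a computation. Its length and the position
  of \<open>\<mu>\<close> must not depend on p, since S6 addresses arguments by position.\<close>

definition wf_env :: "('p \<Rightarrow> val list) \<Rightarrow> bool" where
  "wf_env env \<longleftrightarrow> (\<exists>L. \<forall>p. length (env p) = L) \<and>
     (\<exists>i. \<forall>p. i < length (env p) \<and> env p ! i = V2 feferman_mu)"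

text \<open>One index has to serve all parameters; this is the source of the uniformity in F and
  M.\<close>

definition PR :: "('p \<Rightarrow> val list) \<Rightarrow> ('p \<Rightarrow> nat) \<Rightarrow> bool" where
  "PR env \<phi> \<longleftrightarrow> wf_env env \<and> (\<exists>e. \<forall>p. kleene False e (env p) (\<phi> p))"

definition has :: "('p \<Rightarrow> val list) \<Rightarrow> ('p \<Rightarrow> val) \<Rightarrow> bool" where
  "has env v \<longleftrightarrow> (\<exists>i. \<forall>p. i < length (env p) \<and> env p ! i = v p)"

text \<open>A bound variable becomes a new first argument, and its value the first component of the
  parameter.\<close>

definition push :: "('a \<Rightarrow> val) \<Rightarrow> ('p \<Rightarrow> val list) \<Rightarrow> 'a \<times> 'p \<Rightarrow> val list" where
  push_def [simp]: "push c env q = c (fst q) # env (snd q)"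

lemma wf_env_push: "wf_env env \<Longrightarrow> wf_env (push c env)"
  unfolding wf_env_def push_def by (metis length_Cons nth_Cons_Suc Suc_less_eq)

lemma wf_env_has_mu: "wf_env env \<Longrightarrow> has env (\<lambda>p. V2 feferman_mu)"
  unfolding wf_env_def has_def by blast

lemma PR_wf_env: "PR env \<phi> \<Longrightarrow> wf_env env"
  by (simp add: PR_def)

lemma has_push: "has env v \<Longrightarrow> has (push c env) (\<lambda>q. v (snd q))"
  unfolding has_def push_def by (metis length_Cons nth_Cons_Suc Suc_less_eq)

lemma has_push_head: "has (push c env) (\<lambda>q. c (fst q))"
  unfolding has_def by (rule exI[of _ 0]) simp

lemma PR_const: "wf_env env \<Longrightarrow> PR env (\<lambda>p. c)"
  unfolding PR_def using kleene.S2 by blast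

lemma PR_var:
  assumes "wf_env env" "has env (\<lambda>p. V0 (x p))"
  shows "PR env x"
proof -
  obtain i where i: "\<And>p. i < length (env p)" "\<And>p. env p ! i = V0 (x p)"
    using assms(2) unfolding has_def by blast
  obtain e' where "\<And>as n. i < length as \<Longrightarrow>
     kleene False (list_encode [3]) (as ! i # take i as @ drop (Suc i) as) n \<Longrightarrow> kleene False e' as n"
    using kleene_move_to_front by metis
  then have "kleene False e' (env p) (x p)" for p
    using i by (simp add: kleene.S3)
  then show ?thesis using assms(1) unfolding PR_def by blast
qed

lemma PR_push_head: "wf_env env \<Longrightarrow> PR (push V0 env) (\<lambda>q. fst q)"
  by (intro PR_var wf_env_push has_push_head)

text \<open>Weakening: the new head is carried behind the other arguments, whose number
  \<open>L\<close> is the same for all parameters, and is ignored there.\<close>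

lemma PR_push:
  assumes "PR env \<phi>"
  shows "PR (push c env) (\<lambda>q. \<phi> (snd q))"
proof -
  obtain e L where e: "\<And>p. kleene False e (env p) (\<phi> p)" and L: "\<And>p. length (env p) = L"
    using assms unfolding PR_def wf_env_def by blast
  obtain e' where "\<And>x as n. L \<le> length as \<Longrightarrow>
     kleene False e (take L as @ x # drop L as) n \<Longrightarrow> kleene False e' (x # as) n"
    using kleene_move_from_front by metis
  then have "kleene False e' (push c env q) (\<phi> (snd q))" for q
    using L kleene_append[OF e] by simp
  moreover have "wf_env (push c env)"
    using assms PR_wf_env wf_env_push by blast
  ultimately show ?thesis unfolding PR_def by blast
qed

lemma PR_let:
  assumes "PR env a" "PR (push V0 env) (\<lambda>q. h (fst q) (snd q))"
  shows "PR env (\<lambda>p. h (a p) p)"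
proof -
  obtain e1 e2 where "\<And>p. kleene False e1 (env p) (a p)"
    "\<And>q. kleene False e2 (push V0 env q) (h (fst q) (snd q))"
    using assms unfolding PR_def by blast
  then have "kleene False (list_encode [4, e2, e1]) (env p) (h (a p) p)" for p
    by (metis kleene.S4 fst_conv snd_conv push_def)
  then show ?thesis using assms(1) unfolding PR_def by blast
qed

lemma PR_Suc:
  assumes "PR env a"
  shows "PR env (\<lambda>p. Suc (a p))"
proof (rule PR_let[OF assms, where h = "\<lambda>x p. Suc x"])
  show "PR (push V0 env) (\<lambda>q. Suc (fst q))"
    using wf_env_push[OF PR_wf_env[OF assms]] kleene.S1 unfolding PR_def push_def by blast
qed

text \<open>S5 hands its step the previous value first and the counter second, so
  \<open>fst q\<close> is the value and \<open>fst (snd q)\<close> the counter.\<close>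

lemma PR_rec:
  assumes "PR env a" "PR env n"
    and "PR (push V0 (push V0 env)) (\<lambda>q. b (fst (snd q)) (fst q) (snd (snd q)))"
  shows "PR env (\<lambda>p. rec_nat (a p) (\<lambda>x m. b x m p) (n p))"
proof (rule PR_let[OF assms(2), where h = "\<lambda>k p. rec_nat (a p) (\<lambda>x m. b x m p) k"])
  obtain e1 e2 where e1: "\<And>p. kleene False e1 (env p) (a p)"
    and e2: "\<And>q. kleene False e2 (push V0 (push V0 env) q) (b (fst (snd q)) (fst q) (snd (snd q)))"
    using assms unfolding PR_def by blast
  have e2': "kleene False e2 (V0 m # V0 x # env p) (b x m p)" for m x p
    using e2[of "(m, x, p)"] by simp
  have "kleene False (list_encode [5, e1, e2]) (V0 k # env p) (rec_nat (a p) (\<lambda>x m. b x m p) k)" for k p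
    by (induction k) (auto intro: kleene.S5_0 kleene.S5_Suc e1 e2')
  then have "\<forall>q. kleene False (list_encode [5, e1, e2]) (push V0 env q)
      (rec_nat (a (snd q)) (\<lambda>x m. b x m (snd q)) (fst q))"
    by simp
  then show "PR (push V0 env) (\<lambda>q. rec_nat (a (snd q)) (\<lambda>x m. b x m (snd q)) (fst q))"
    using wf_env_push[OF PR_wf_env[OF assms(1)]] unfolding PR_def by blast
qed

lemma kleene_swap_front:
  "kleene False e (y # x # as) n \<Longrightarrow> kleene False (list_encode [6, e, 0]) (x # y # as) n"
  by (rule kleene.S6) simp_all

lemma PR_app1:
  assumes "has env (\<lambda>p. V1 (f p))" "PR env a"
  shows "PR env (\<lambda>p. f p (a p))"
proof (rule PR_let[OF assms(2), where h = "\<lambda>x p. f p x"])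
  obtain i where i: "\<And>p. i < length (env p)" "\<And>p. env p ! i = V1 (f p)"
    using assms(1) unfolding has_def by blast
  obtain e' where "\<And>as n. Suc i < length as \<Longrightarrow>
     kleene False (list_encode [6, list_encode [7], 0]) (as ! Suc i # take (Suc i) as @ drop (Suc (Suc i)) as) n
      \<Longrightarrow> kleene False e' as n"
    using kleene_move_to_front by metis
  then have "kleene False e' (push V0 env q) (f (snd q) (fst q))" for q
    using i by (simp add: kleene_swap_front kleene.S7)
  then show "PR (push V0 env) (\<lambda>q. f (snd q) (fst q))"
    using wf_env_push[OF PR_wf_env[OF assms(2)]] unfolding PR_def by blast
qed

text \<open>S8 wants the oracle in front and puts the bound variable before it, whereas
  \<open>e\<close> expects the oracle at its old place. After a swap of the two, the oracle is
  carried back past the variable to that place.\<close>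

lemma kleene_under_oracle:
  assumes "\<And>q. kleene False e (push c env q) (h q)" "\<And>p. i < length (env p)"
  shows "\<exists>e'. \<forall>x p. kleene False e' (c x # env p ! i # take i (env p) @ drop (Suc i) (env p)) (h (x, p))"
proof -
  obtain e' where e': "\<And>x as n. Suc i \<le> length as \<Longrightarrow>
     kleene False e (take (Suc i) as @ x # drop (Suc i) as) n \<Longrightarrow> kleene False e' (x # as) n"
    using kleene_move_from_front by metis
  have "kleene False e' (env p ! i # c x # take i (env p) @ drop (Suc i) (env p)) (h (x, p))" for x p
    using assms(1)[of "(x, p)"] assms(2)[of p]
    by (intro e') (simp_all add: id_take_nth_drop[symmetric])
  then show ?thesis using kleene_swap_front by blast
qed

lemma PR_app2:
  assumes "has env (\<lambda>p. V2 (H p))" "PR (push V0 env) (\<lambda>q. h (fst q) (snd q))" "wf_env env"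
  shows "PR env (\<lambda>p. H p (\<lambda>x. h x p))"
proof -
  obtain i where i: "\<And>p. i < length (env p)" "\<And>p. env p ! i = V2 (H p)"
    using assms(1) unfolding has_def by blast
  obtain e where e: "\<And>q. kleene False e (push V0 env q) (h (fst q) (snd q))"
    using assms(2) unfolding PR_def by blast
  obtain e1 where "\<And>x p. kleene False e1 (V0 x # V2 (H p) # take i (env p) @ drop (Suc i) (env p)) (h x p)"
    using kleene_under_oracle[where h = "\<lambda>q. h (fst q) (snd q)", OF e i(1)] i(2) by auto
  moreover obtain e' where "\<And>as n. i < length as \<Longrightarrow>
     kleene False (list_encode [8, e1]) (as ! i # take i as @ drop (Suc i) as) n \<Longrightarrow> kleene False e' as n"
    using kleene_move_to_front by metis
  ultimately have "kleene False e' (env p) (H p (\<lambda>x. h x p))" for p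
    using i by (simp add: kleene.S8_2)
  then show ?thesis using assms(3) unfolding PR_def by blast
qed

lemma PR_app3:
  assumes "has env (\<lambda>p. V3 (M p))" "PR (push V1 env) (\<lambda>q. h (fst q) (snd q))" "wf_env env"
  shows "PR env (\<lambda>p. M p (\<lambda>f. h f p))"
proof -
  obtain i where i: "\<And>p. i < length (env p)" "\<And>p. env p ! i = V3 (M p)"
    using assms(1) unfolding has_def by blast
  obtain e where e: "\<And>q. kleene False e (push V1 env q) (h (fst q) (snd q))"
    using assms(2) unfolding PR_def by blast
  obtain e1 where "\<And>x p. kleene False e1 (V1 x # V3 (M p) # take i (env p) @ drop (Suc i) (env p)) (h x p)"
    using kleene_under_oracle[where h = "\<lambda>q. h (fst q) (snd q)", OF e i(1)] i(2) by auto
  moreover obtain e' where "\<And>as n. i < length as \<Longrightarrow>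
     kleene False (list_encode [8, e1]) (as ! i # take i as @ drop (Suc i) as) n \<Longrightarrow> kleene False e' as n"
    using kleene_move_to_front by metis
  ultimately have "kleene False e' (env p) (M p (\<lambda>f. h f p))" for p
    using i by (simp add: kleene.S8_3)
  then show ?thesis using assms(3) unfolding PR_def by blast
qed

lemma PR_mu: "PR (push V0 env) (\<lambda>q. h (fst q) (snd q)) \<Longrightarrow> wf_env env \<Longrightarrow>
    PR env (\<lambda>p. feferman_mu (\<lambda>x. h x p))"
  by (rule PR_app2[where H = "\<lambda>p. feferman_mu"]) (simp_all add: wf_env_has_mu)

lemma PR_ifz: "PR env n \<Longrightarrow> PR env a \<Longrightarrow> PR env b \<Longrightarrow> PR env (\<lambda>p. if n p = 0 then a p else b p)"
proof -
  assume *: "PR env n" "PR env a" "PR env b"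
  have "PR env (\<lambda>p. rec_nat (a p) (\<lambda>x m. b p) (n p))"
    by (intro PR_rec PR_push *)
  moreover have "rec_nat (a p) (\<lambda>x m. b p) (n p) = (if n p = 0 then a p else b p)" for p
    by (cases "n p") auto
  ultimately show ?thesis by simp
qed

lemma PR_pred:
  assumes "PR env n" shows "PR env (\<lambda>p. n p - 1)"
proof -
  have "PR env (\<lambda>p. rec_nat 0 (\<lambda>x m. x) (n p))"
    by (intro PR_rec PR_push PR_push_head PR_const assms PR_wf_env[OF assms])
  moreover have "rec_nat 0 (\<lambda>x m. x) (n p) = n p - 1" for p
    by (cases "n p") auto
  ultimately show ?thesis by simp
qed

lemma PR_add:
  assumes "PR env a" "PR env b" shows "PR env (\<lambda>p. a p + b p)"
proof -
  have "PR env (\<lambda>p. rec_nat (a p) (\<lambda>x m. Suc m) (b p))"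
    by (intro PR_rec PR_Suc PR_push_head assms wf_env_push PR_wf_env[OF assms(1)])
  moreover have "rec_nat a (\<lambda>x m. Suc m) b = a + b" for a b :: nat
    by (induction b) auto
  ultimately show ?thesis by simp
qed

lemma PR_diff:
  assumes "PR env a" "PR env b" shows "PR env (\<lambda>p. a p - b p)"
proof -
  have "PR env (\<lambda>p. rec_nat (a p) (\<lambda>x m. m - 1) (b p))"
    by (intro PR_rec PR_pred PR_push_head assms wf_env_push PR_wf_env[OF assms(1)])
  moreover have "rec_nat a (\<lambda>x m. m - 1) b = a - b" for a b :: nat
    by (induction b) auto
  ultimately show ?thesis by simp
qed

section \<open>Predicates, search and number quantifiers\<close>

definition PRP :: "('p \<Rightarrow> val list) \<Rightarrow> ('p \<Rightarrow> bool) \<Rightarrow> bool" where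
  "PRP env P \<longleftrightarrow> PR env (\<lambda>p. if P p then 0 else 1)"

lemma PRP_wf_env: "PRP env P \<Longrightarrow> wf_env env"
  unfolding PRP_def by (rule PR_wf_env)

lemma PRP_eq_0:
  assumes "PR env a" shows "PRP env (\<lambda>p. a p = 0)"
  unfolding PRP_def by (intro PR_ifz PR_const assms PR_wf_env[OF assms])

lemma PRP_eq:
  assumes "PR env a" "PR env b" shows "PRP env (\<lambda>p. a p = b p)"
proof -
  have "PRP env (\<lambda>p. (a p - b p) + (b p - a p) = 0)"
    by (intro PRP_eq_0 PR_add PR_diff assms)
  moreover have "(a p - b p) + (b p - a p) = 0 \<longleftrightarrow> a p = b p" for p by auto
  ultimately show ?thesis by simp
qed

lemma PRP_less:
  assumes "PR env a" "PR env b" shows "PRP env (\<lambda>p. a p < b p)"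
proof -
  have "PRP env (\<lambda>p. Suc (a p) - b p = 0)"
    by (intro PRP_eq_0 PR_diff PR_Suc assms)
  moreover have "Suc (a p) - b p = 0 \<longleftrightarrow> a p < b p" for p by auto
  ultimately show ?thesis by simp
qed

lemma PR_if:
  assumes "PRP env P" "PR env a" "PR env b"
  shows "PR env (\<lambda>p. if P p then a p else b p)"
proof -
  have "PR env (\<lambda>p. if (if P p then 0 else 1 :: nat) = 0 then a p else b p)"
    by (intro PR_ifz assms assms(1)[unfolded PRP_def])
  moreover have "(if (if P p then 0 else 1 :: nat) = 0 then a p else b p) = (if P p then a p else b p)" for p
    by auto
  ultimately show ?thesis by simp
qed

lemma PRP_not:
  assumes "PRP env P" shows "PRP env (\<lambda>p. \<not> P p)"
proof -
  have "PR env (\<lambda>p. if P p then 1 else 0)"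
    by (intro PR_if PR_const assms PRP_wf_env[OF assms])
  moreover have "(if P p then 1 else 0 :: nat) = (if \<not> P p then 0 else 1)" for p
    by auto
  ultimately show ?thesis by (simp add: PRP_def)
qed

lemma PRP_conj:
  assumes "PRP env P" "PRP env Q" shows "PRP env (\<lambda>p. P p \<and> Q p)"
proof -
  have "PR env (\<lambda>p. if P p then if Q p then 0 else 1 else 1)"
    by (intro PR_if PR_const assms PRP_wf_env[OF assms(1)])
  moreover have "(if P p then if Q p then 0 else 1 else 1 :: nat) = (if P p \<and> Q p then 0 else 1)" for p
    by auto
  ultimately show ?thesis by (simp add: PRP_def)
qed

lemma PRP_imp:
  assumes "PRP env P" "PRP env Q" shows "PRP env (\<lambda>p. P p \<longrightarrow> Q p)"
proof -
  have "PRP env (\<lambda>p. \<not> (P p \<and> \<not> Q p))"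
    by (intro PRP_not PRP_conj assms)
  then show ?thesis by simp
qed

lemma PRP_disj:
  assumes "PRP env P" "PRP env Q" shows "PRP env (\<lambda>p. P p \<or> Q p)"
proof -
  have "PRP env (\<lambda>p. \<not> (\<not> P p \<and> \<not> Q p))"
    by (intro PRP_not PRP_conj assms)
  then show ?thesis by simp
qed

text \<open>Total, with value 0 if nothing satisfies \<open>P\<close>; hence searches may fail
  without making a computation diverge.\<close>

definition search :: "(nat \<Rightarrow> bool) \<Rightarrow> nat" where
  "search P = feferman_mu (\<lambda>x. if P x then 0 else 1)"

lemma search_holds:
  assumes "P x" shows "P (search P)"
proof -
  have "search P = (LEAST x. P x)"
    using assms by (auto simp: search_def feferman_mu_def)
  then show ?thesis using assms by (metis LeastI)
qed

lemma search_le: "P x \<Longrightarrow> search P \<le> x"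
  by (auto simp: search_def feferman_mu_def intro: Least_le)

lemma search_unique: "P x \<Longrightarrow> (\<And>y. P y \<Longrightarrow> y = x) \<Longrightarrow> search P = x"
  by (metis search_holds)

lemma PR_search:
  "PRP (push V0 env) (\<lambda>q. P (fst q) (snd q)) \<Longrightarrow> wf_env env \<Longrightarrow> PR env (\<lambda>p. search (\<lambda>x. P x p))"
  unfolding search_def PRP_def by (rule PR_mu)

text \<open>The number delivered by \<open>search\<close> satisfies the predicate as soon as any
  number does, so one test decides the quantifier. This is what makes arithmetical predicates
  available.\<close>

lemma PRP_ex:
  assumes "PRP (push V0 env) (\<lambda>q. P (fst q) (snd q))" "wf_env env"
  shows "PRP env (\<lambda>p. \<exists>x. P x p)"
proof -
  have "PR env (\<lambda>p. if P (search (\<lambda>x. P x p)) p then 0 else 1)"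
    by (rule PR_let[OF PR_search[OF assms], where h = "\<lambda>x p. if P x p then 0 else 1"])
      (rule assms(1)[unfolded PRP_def])
  moreover have "P (search (\<lambda>x. P x p)) p \<longleftrightarrow> (\<exists>x. P x p)" for p
    using search_holds[of "\<lambda>x. P x p"] by blast
  ultimately show ?thesis by (simp add: PRP_def)
qed

lemma PRP_all:
  assumes "PRP (push V0 env) (\<lambda>q. P (fst q) (snd q))" "wf_env env"
  shows "PRP env (\<lambda>p. \<forall>x. P x p)"
proof -
  have "PRP env (\<lambda>p. \<not> (\<exists>x. \<not> P x p))"
    by (intro PRP_not PRP_ex assms)
  then show ?thesis by simp
qed

lemmas PR_intros = PR_push_head PR_push has_push has_push_head wf_env_push PR_const PR_Suc
  PR_add PR_diff PR_rec PR_search PR_if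
  PRP_eq PRP_less PRP_not PRP_conj PRP_imp PRP_ex

lemma PR_prod_encode:
  assumes "PR env a" "PR env b" shows "PR env (\<lambda>p. prod_encode (a p, b p))"
proof -
  \<comment> \<open>The triangular numbers in the library's pairing function arise by
    recursion.\<close>
  have "rec_nat 0 (\<lambda>x m. m + Suc x) n = triangle n" for n
    by (induction n) auto
  moreover have "PR env (\<lambda>p. rec_nat 0 (\<lambda>x m. m + Suc x) (a p + b p) + a p)"
    by (intro PR_intros assms PR_wf_env[OF assms(1)])
  ultimately show ?thesis by (simp add: prod_encode_def)
qed

lemma PR_fst_prod_decode:
  assumes "PR env z" shows "PR env (\<lambda>p. fst (prod_decode (z p)))"
proof -
  have "search (\<lambda>a. \<exists>b. prod_encode (a, b) = n) = fst (prod_decode n)" for n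
    by (rule search_unique) (metis prod.collapse prod_decode_inverse, metis fst_conv prod_encode_inverse)
  moreover have "PR env (\<lambda>p. search (\<lambda>a. \<exists>b. prod_encode (a, b) = z p))"
    by (intro PR_prod_encode PR_intros assms PR_wf_env[OF assms(1)])
  ultimately show ?thesis by simp
qed

lemma PR_snd_prod_decode:
  assumes "PR env z" shows "PR env (\<lambda>p. snd (prod_decode (z p)))"
proof -
  have "search (\<lambda>b. \<exists>a. prod_encode (a, b) = n) = snd (prod_decode n)" for n
    by (rule search_unique) (metis prod.collapse prod_decode_inverse, metis snd_conv prod_encode_inverse)
  moreover have "PR env (\<lambda>p. search (\<lambda>b. \<exists>a. prod_encode (a, b) = z p))"
    by (intro PR_prod_encode PR_intros assms PR_wf_env[OF assms(1)])
  ultimately show ?thesis by simp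
qed

section \<open>Coded lists\<close>

definition hdc :: "nat \<Rightarrow> nat" where "hdc c = fst (prod_decode (c - 1))"
definition tlc :: "nat \<Rightarrow> nat" where "tlc c = snd (prod_decode (c - 1))"
definition consc :: "nat \<Rightarrow> nat \<Rightarrow> nat" where "consc x c = Suc (prod_encode (x, c))"
definition dropc :: "nat \<Rightarrow> nat \<Rightarrow> nat" where "dropc k c = rec_nat c (\<lambda>i m. tlc m) k"
definition nthc :: "nat \<Rightarrow> nat \<Rightarrow> nat" where "nthc c k = hdc (dropc k c)"
text \<open>Reversing a prefix onto another list is a plain recursion; doing so twice restores the
  order, which gives \<open>takec\<close> and \<open>swapc\<close>.\<close>

definition revappc :: "nat \<Rightarrow> nat \<Rightarrow> nat \<Rightarrow> nat" where
  "revappc k c d = rec_nat d (\<lambda>i m. consc (nthc c i) m) k"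
definition takec :: "nat \<Rightarrow> nat \<Rightarrow> nat" where
  "takec m c = revappc m (revappc m c 0) 0"
definition swapc :: "nat \<Rightarrow> nat \<Rightarrow> nat" where
  "swapc i c = revappc i (revappc i c 0)
     (consc (nthc c (Suc i)) (consc (nthc c i) (dropc (Suc (Suc i)) c)))"

lemma hdc_Cons [simp]: "hdc (list_encode (x # xs)) = x"
  by (simp add: hdc_def list_encode.simps)

text \<open>Makes the coded tail of the empty list empty, in accordance with
  \<open>tl []\<close>.\<close>

lemma prod_decode_0 [simp]: "prod_decode 0 = (0, 0)"
proof -
  have "prod_encode (0, 0) = 0" by (simp add: prod_encode_def)
  then show ?thesis by (metis prod_encode_inverse)
qed

lemma tlc_encode [simp]: "tlc (list_encode xs) = list_encode (tl xs)"
  by (cases xs) (simp_all add: tlc_def list_encode.simps)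

lemma consc_encode [simp]: "consc x (list_encode xs) = list_encode (x # xs)"
  by (simp add: consc_def list_encode.simps)

lemma dropc_encode [simp]: "dropc k (list_encode xs) = list_encode (drop k xs)"
  by (induction k) (simp_all add: dropc_def drop_Suc tl_drop)

lemma nthc_encode [simp]: "k < length xs \<Longrightarrow> nthc (list_encode xs) k = xs ! k"
  by (simp add: nthc_def Cons_nth_drop_Suc[symmetric])

lemma revappc_encode [simp]:
  "k \<le> length xs \<Longrightarrow> revappc k (list_encode xs) (list_encode ys) = list_encode (rev (take k xs) @ ys)"
  by (induction k) (simp_all add: revappc_def take_Suc_conv_app_nth)

lemma takec_encode [simp]:
  assumes "k \<le> length xs" shows "takec k (list_encode xs) = list_encode (take k xs)"
  using assms revappc_encode[of k xs "[]"] revappc_encode[of k "rev (take k xs)" "[]"]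
  by (simp add: takec_def list_encode.simps(1))

lemma swapc_encode [simp]:
  assumes "Suc i < length xs"
  shows "swapc i (list_encode xs) = list_encode ((xs[i := xs ! Suc i])[Suc i := xs ! i])"
proof -
  have "(xs[i := xs ! Suc i])[Suc i := xs ! i] = take i xs @ xs ! Suc i # xs ! i # drop (Suc (Suc i)) xs"
    using assms by (intro nth_equalityI) (auto simp: nth_append nth_list_update nth_Cons split: nat.splits intro!: arg_cong[of _ _ "(!) xs"])
  then show ?thesis
    using assms revappc_encode[of i xs "[]"]
    by (simp add: swapc_def list_encode.simps(1))
qed

lemma PR_hdc: "PR env c \<Longrightarrow> PR env (\<lambda>p. hdc (c p))"
  unfolding hdc_def by (intro PR_fst_prod_decode PR_pred)

lemma PR_tlc: "PR env c \<Longrightarrow> PR env (\<lambda>p. tlc (c p))"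
  unfolding tlc_def by (intro PR_snd_prod_decode PR_pred)

lemma PR_consc: "PR env x \<Longrightarrow> PR env c \<Longrightarrow> PR env (\<lambda>p. consc (x p) (c p))"
  unfolding consc_def by (intro PR_prod_encode PR_Suc)

lemma PR_dropc:
  assumes "PR env k" "PR env c" shows "PR env (\<lambda>p. dropc (k p) (c p))"
  unfolding dropc_def by (intro PR_rec PR_tlc PR_push_head wf_env_push assms PR_wf_env[OF assms(1)])

lemma PR_nthc: "PR env c \<Longrightarrow> PR env k \<Longrightarrow> PR env (\<lambda>p. nthc (c p) (k p))"
  unfolding nthc_def by (intro PR_hdc PR_dropc)

lemma PR_revappc:
  assumes "PR env k" "PR env c" "PR env d" shows "PR env (\<lambda>p. revappc (k p) (c p) (d p))"
  unfolding revappc_def by (intro PR_intros PR_consc PR_nthc assms PR_wf_env[OF assms(1)])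

lemma PR_takec:
  assumes "PR env k" "PR env c" shows "PR env (\<lambda>p. takec (k p) (c p))"
  unfolding takec_def by (intro PR_revappc PR_const assms PR_wf_env[OF assms(1)])

lemma PR_swapc:
  assumes "PR env k" "PR env c" shows "PR env (\<lambda>p. swapc (k p) (c p))"
  unfolding swapc_def
  by (intro PR_revappc PR_consc PR_nthc PR_dropc PR_Suc PR_const assms PR_wf_env[OF assms(1)])

section \<open>Subcomputations\<close>

text \<open>Both S8 schemes have the same indices; the type of the first argument tells them
  apart.\<close>

inductive_cases kleene_oracle2E: "kleene b (list_encode [8, e]) (V2 F # as) m"
inductive_cases kleene_oracle3E: "kleene b (list_encode [8, e]) (V3 M # as) m"

lemma kleene_deterministic:
  assumes "kleene b e as n" "kleene b e as m"
  shows "n = m"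
proof -
  \<comment> \<open>The conclusion must not mention the value \<open>F g\<close> of the oracle schemes, as it would make
    higher-order unification diverge; hence the variable \<open>n'\<close>.\<close>
  have "n' = m" if "kleene b e as n" "n' = n" "kleene b e as m" for n'
    using that
  proof (induction arbitrary: n' m)
    case (S4 e2 as k e1 n)
    from S4.prems(2) obtain k' where "kleene b e2 as k'" and m: "kleene b e1 (V0 k' # as) m"
      by cases auto
    then have "k = k'" using S4.IH(1) by blast
    with m show ?case using S4.IH(2) S4.prems(1) by blast
  next
    case (S5_0 e1 as n e2)
    from S5_0.prems(2,1) S5_0.IH show ?case by cases auto
  next
    case (S5_Suc e1 e2 x as k n)
    from S5_Suc.prems(2) obtain k' where "kleene b (list_encode [5, e1, e2]) (V0 x # as) k'"
      and m: "kleene b e2 (V0 k' # V0 x # as) m"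
      by cases auto
    then have "k = k'" using S5_Suc.IH(1) by blast
    with m show ?case using S5_Suc.IH(2) S5_Suc.prems(1) by blast
  next
    case (S6 i as e n)
    from S6.prems(2,1) S6.IH show ?case by cases auto
  next
    case (S9 l as e n)
    from S9.prems(2,1) S9.IH show ?case by cases auto
  next
    case (S8_2 e1 F as g)
    from S8_2.prems(2) obtain g' where m: "m = F g'" and g': "\<And>x. kleene b e1 (V0 x # V2 F # as) (g' x)"
      by (elim kleene_oracle2E) blast
    have "g = g'" using S8_2.IH g' by blast
    with m S8_2.prems(1) show ?case by simp
  next
    case (S8_3 e1 M as G)
    from S8_3.prems(2) obtain G' where m: "m = M G'" and G': "\<And>f. kleene b e1 (V1 f # V3 M # as) (G' f)"
      by (elim kleene_oracle3E) blast
    have "G = G'" using S8_3.IH G' by blast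
    with m S8_3.prems(1) show ?case by simp
  qed (erule kleene.cases; simp)+
  then show ?thesis using assms by blast
qed

text \<open>Argument lists built from F, \<open>\<mu>\<close> and numbers are coded by lists of numbers, with 0 for F,
  1 for \<open>\<mu>\<close> and \<open>x + 2\<close> for the number x. The node number 0 stands for an absent subcomputation.\<close>

definition arg :: "((nat \<Rightarrow> nat) \<Rightarrow> nat) \<Rightarrow> nat \<Rightarrow> val" where
  "arg F c = (if c = 0 then V2 F else if c = 1 then V2 feferman_mu else V0 (c - 2))"

definition node :: "nat \<Rightarrow> nat \<Rightarrow> nat" where
  "node e c = Suc (prod_encode (e, c))"

definition index :: "nat \<Rightarrow> nat" where "index t = fst (prod_decode (t - 1))"
definition args :: "nat \<Rightarrow> nat" where "args t = snd (prod_decode (t - 1))"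

text \<open>\<open>sub v t i\<close> is the i-th immediate subcomputation of t and \<open>loc F v t\<close> the value of t, both computed
  on the assumption that v gives the values of the preceding subcomputations.\<close>

definition sub0 :: "nat \<Rightarrow> nat" where
  "sub0 t = (let e = index t; c = args t; s = nthc e 0 in
     if s = 4 then node (nthc e 2) c
     else if s = 5 then
       (if hdc c = 2 then node (nthc e 1) (tlc c) else node e (consc (hdc c - 1) (tlc c)))
     else if s = 6 then node (nthc e 1) (swapc (nthc e 2) c)
     else if s = 9 then node (hdc c - 2) (takec (nthc e 1) (tlc c))
     else 0)"

text \<open>Only S4 and the step of S5 have a second subcomputation. Its first argument is the value
  of the first one, coded by adding 2; head code 2 is the number 0, the base case of S5.\<close>

definition sub1 :: "(nat \<Rightarrow> nat) \<Rightarrow> nat \<Rightarrow> nat" where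
  "sub1 v t = (let e = index t; c = args t; s = nthc e 0 in
     if s = 4 then node (nthc e 1) (consc (v (sub0 t) + 2) c)
     else if s = 5 \<and> hdc c \<noteq> 2 then
       node (nthc e 2) (consc (v (sub0 t) + 2) (consc (hdc c - 1) (tlc c)))
     else 0)"

text \<open>S8 branches over all numbers \<open>i\<close>; every other scheme has at most two
  subcomputations.\<close>

definition sub :: "(nat \<Rightarrow> nat) \<Rightarrow> nat \<Rightarrow> nat \<Rightarrow> nat" where
  "sub v t i =
     (if nthc (index t) 0 = 8 then node (nthc (index t) 1) (consc (i + 2) (args t))
      else if i = 0 then sub0 t else if i = 1 then sub1 v t else 0)"

definition loc :: "((nat \<Rightarrow> nat) \<Rightarrow> nat) \<Rightarrow> (nat \<Rightarrow> nat) \<Rightarrow> nat \<Rightarrow> nat" where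
  "loc F v t = (let e = index t; c = args t; s = nthc e 0 in
     if s = 1 then hdc c - 1
     else if s = 2 then nthc e 1
     else if s = 3 then hdc c - 2
     else if s = 8 then
       (if hdc c = 0 then F (\<lambda>i. v (sub v t i)) else feferman_mu (\<lambda>i. v (sub v t i)))
     else if s = 4 \<or> s = 5 \<and> hdc c \<noteq> 2 then v (sub1 v t)
     else v (sub0 t))"

definition terminates :: "((nat \<Rightarrow> nat) \<Rightarrow> nat) \<Rightarrow> nat \<Rightarrow> nat \<Rightarrow> bool" where
  "terminates F t n \<longleftrightarrow> (\<exists>e cs. t = node e (list_encode cs) \<and> kleene True e (map (arg F) cs) n)"

definition agrees :: "((nat \<Rightarrow> nat) \<Rightarrow> nat) \<Rightarrow> (nat \<Rightarrow> nat) \<Rightarrow> nat \<Rightarrow> bool" where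
  "agrees F v t \<longleftrightarrow> t = 0 \<or> terminates F t (v t)"

lemma index_node [simp]: "index (node e c) = e" and args_node [simp]: "args (node e c) = c"
  by (simp_all add: index_def args_def node_def)

lemma node_inject [simp]: "node e c = node e' c' \<longleftrightarrow> e = e' \<and> c = c'"
  by (simp add: node_def)

lemma node_neq_0 [simp]: "node e c \<noteq> 0"
  by (simp add: node_def)

lemma terminates_node [simp]:
  "terminates F (node e (list_encode cs)) n \<longleftrightarrow> kleene True e (map (arg F) cs) n"
  by (auto simp: terminates_def)

lemma terminates_deterministic: "terminates F t n \<Longrightarrow> terminates F t m \<Longrightarrow> n = m"
  by (auto simp: terminates_def dest: kleene_deterministic)

lemma arg_eq [simp]:
  "arg F c = V0 x \<longleftrightarrow> c = x + 2" "V0 x = arg F c \<longleftrightarrow> c = x + 2"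
  "arg F c \<noteq> V1 f" "V1 f \<noteq> arg F c" "arg F c \<noteq> V3 M" "V3 M \<noteq> arg F c"
  by (auto simp: arg_def)

lemma arg_V0 [simp]: "arg F (Suc (Suc x)) = V0 x"
  by (simp add: arg_def)

text \<open>Rule induction over the computation, recast for an arbitrary assignment
  \<open>v\<close>. The premises of each scheme are listed so that the i-th one is a true
  subcomputation once \<open>v\<close> is right about those before it, and the value is right once
  \<open>v\<close> is right about all.\<close>

lemma terminates_induct [consumes 1, case_names step]:
  assumes "terminates F t n"
    and step: "\<And>t n. terminates F t n \<Longrightarrow>
      (\<And>v i. \<forall>j<i. agrees F v (sub v t j) \<Longrightarrow>
         sub v t i = 0 \<or> (\<exists>m. terminates F (sub v t i) m \<and> Q (sub v t i) m)) \<Longrightarrow>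
      (\<And>v. \<forall>j. agrees F v (sub v t j) \<Longrightarrow> loc F v t = n) \<Longrightarrow> Q t n"
  shows "Q t n"
proof -
  \<comment> \<open>The variable \<open>n'\<close> keeps the oracle application in the conclusion of
    S8 out of the goal of the induction.\<close>
  have "Q (node e (list_encode cs)) n'" if "kleene True e (map (arg F) cs) n" "n' = n" for e cs n n'
    using that
  proof (induction e "map (arg F) cs" n arbitrary: cs n')
    case (S1 x as)
    then obtain cs' where [simp]: "cs = (x + 2) # cs'" by auto
    have "Q (node (list_encode [1]) (list_encode cs)) (Suc x)"
      by (rule step) (auto simp: sub_def sub0_def sub1_def loc_def intro: kleene.S1[unfolded One_nat_def])
    then show ?case using S1.prems by simp
  next
    case (S2 q)
    have "Q (node (list_encode [2, q]) (list_encode cs)) q"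
      by (rule step) (auto simp: sub_def sub0_def sub1_def loc_def intro: kleene.S2)
    then show ?case using S2.prems by simp
  next
    case (S3 x as)
    then obtain cs' where [simp]: "cs = (x + 2) # cs'" by auto
    have "Q (node (list_encode [3]) (list_encode cs)) x"
      by (rule step) (auto simp: sub_def sub0_def sub1_def loc_def intro: kleene.S3)
    then show ?case using S3.prems by simp
  next
    case (S4 e2 m e1 n)
    let ?t = "node (list_encode [4, e1, e2]) (list_encode cs)"
    let ?u = "node e2 (list_encode cs)"
    have s: "sub v ?t i = (if i = 0 then ?u else if i = 1
        then node e1 (list_encode (Suc (Suc (v ?u)) # cs)) else 0)" for v i
      by (simp add: sub_def sub0_def sub1_def)
    have l: "loc F v ?t = v (sub v ?t 1)" for v
      by (simp add: sub_def loc_def)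
    have u: "v ?u = m" if "agrees F v ?u" for v
      using that S4(1) by (auto simp: agrees_def dest: kleene_deterministic)
    have q0: "Q ?u m" by (rule S4(2)) simp_all
    have q: "Q (node e1 (list_encode (Suc (Suc m) # cs))) n"
      by (rule S4(4)) simp_all
    have k: "kleene True e1 (V0 m # map (arg F) cs) n" by (rule S4(3))
    have "Q ?t n"
    proof (rule step)
      show "terminates F ?t n" using S4(1,3) by (simp add: kleene.S4)
    next
      fix v i assume *: "\<forall>j<i. agrees F v (sub v ?t j)"
      \<comment> \<open>The second node depends on \<open>v\<close> through the value at the first,
        which the assumption for \<open>j = 0\<close> fixes.\<close>
      have "v ?u = m" if "i = 1" using *[rule_format, of 0] that by (intro u) (simp add: s)
      then show "sub v ?t i = 0 \<or> (\<exists>m. terminates F (sub v ?t i) m \<and> Q (sub v ?t i) m)"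
        using S4(1) q0 q k by (auto simp: s)
    next
      fix v assume *: "\<forall>j. agrees F v (sub v ?t j)"
      then have "v ?u = m" by (metis u s)
      then show "loc F v ?t = n"
        using *[rule_format, of 1] k by (auto simp: l s agrees_def dest: kleene_deterministic)
    qed
    then show ?case using S4.prems by simp
  next
    case (S5_0 e1 as n e2)
    then obtain cs' where [simp]: "cs = 2 # cs'" "as = map (arg F) cs'"
      by auto
    let ?t = "node (list_encode [5, e1, e2]) (list_encode (2 # cs'))"
    have s: "sub v ?t i = (if i = 0 then node e1 (list_encode cs') else 0)" for v i
      by (simp add: sub_def sub0_def sub1_def)
    have l: "loc F v ?t = v (sub v ?t 0)" for v
      by (simp add: sub_def loc_def)
    have q: "Q (node e1 (list_encode cs')) n" by (rule S5_0(2)) simp_all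
    have "Q ?t n"
    proof (rule step)
      show "terminates F ?t n" using S5_0(1) by (simp add: kleene.S5_0 numeral_2_eq_2)
    next
      fix v i show "sub v ?t i = 0 \<or> (\<exists>m. terminates F (sub v ?t i) m \<and> Q (sub v ?t i) m)"
        using S5_0(1) q by (auto simp: s)
    next
      fix v assume *: "\<forall>j. agrees F v (sub v ?t j)"
      then show "loc F v ?t = n"
        using *[rule_format, of 0] S5_0(1) by (auto simp: l s agrees_def dest: kleene_deterministic)
    qed
    then show ?case using S5_0.prems by simp
  next
    case (S5_Suc e1 e2 x as m n)
    then obtain cs' where [simp]: "cs = Suc (Suc (Suc x)) # cs'" "as = map (arg F) cs'"
      by auto
    let ?t = "node (list_encode [5, e1, e2]) (list_encode (Suc (Suc (Suc x)) # cs'))"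
    let ?u = "node (list_encode [5, e1, e2]) (list_encode (Suc (Suc x) # cs'))"
    have s: "sub v ?t i = (if i = 0 then ?u else if i = 1
        then node e2 (list_encode (Suc (Suc (v ?u)) # Suc (Suc x) # cs')) else 0)" for v i
      by (simp add: sub_def sub0_def sub1_def)
    have l: "loc F v ?t = v (sub v ?t 1)" for v
      by (simp add: sub_def loc_def)
    have k1: "kleene True (list_encode [5, e1, e2]) (V0 x # map (arg F) cs') m"
      using S5_Suc(1) by simp
    have k2: "kleene True e2 (V0 m # V0 x # map (arg F) cs') n" using S5_Suc(3) by simp
    have u: "v ?u = m" if "agrees F v ?u" for v
      using that k1 by (auto simp: agrees_def dest: kleene_deterministic)
    have q1: "Q ?u m" by (rule S5_Suc(2)) (simp_all)
    have q2: "Q (node e2 (list_encode (Suc (Suc m) # Suc (Suc x) # cs'))) n"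
      by (rule S5_Suc(4)) (simp_all)
    have "Q ?t n"
    proof (rule step)
      show "terminates F ?t n" using k1 k2 by (simp add: kleene.S5_Suc)
    next
      fix v i assume *: "\<forall>j<i. agrees F v (sub v ?t j)"
      have "v ?u = m" if "i = 1" using *[rule_format, of 0] that by (intro u) (simp add: s)
      then show "sub v ?t i = 0 \<or> (\<exists>m. terminates F (sub v ?t i) m \<and> Q (sub v ?t i) m)"
        using k1 k2 q1 q2 by (auto simp: s)
    next
      fix v assume *: "\<forall>j. agrees F v (sub v ?t j)"
      then have "v ?u = m" by (metis u s)
      then show "loc F v ?t = n"
        using *[rule_format, of 1] k2 by (auto simp: l s agrees_def dest: kleene_deterministic)
    qed
    then show ?case using S5_Suc.prems by simp
  next
    case (S6 i e n)
    let ?t = "node (list_encode [6, e, i]) (list_encode cs)"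
    let ?u = "node e (list_encode (cs[i := cs ! Suc i, Suc i := cs ! i]))"
    have i: "Suc i < length cs" using S6(1) by simp
    have s: "sub v ?t k = (if k = 0 then ?u else 0)" for v k
      using i by (simp add: sub_def sub0_def sub1_def)
    have l: "loc F v ?t = v (sub v ?t 0)" for v
      by (simp add: sub_def loc_def)
    have k: "kleene True e (map (arg F) (cs[i := cs ! Suc i, Suc i := cs ! i])) n"
      using S6(2) i by (simp add: map_update)
    have q: "Q ?u n" using i by (intro S6(3)) (simp_all add: map_update)
    have "Q ?t n"
    proof (rule step)
      show "terminates F ?t n" using S6(1,2) by (simp add: kleene.S6)
    next
      fix v k show "sub v ?t k = 0 \<or> (\<exists>m. terminates F (sub v ?t k) m \<and> Q (sub v ?t k) m)"
        using k q by (auto simp: s)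
    next
      fix v assume *: "\<forall>j. agrees F v (sub v ?t j)"
      then show "loc F v ?t = n"
        using *[rule_format, of 0] k by (auto simp: l s agrees_def dest: kleene_deterministic)
    qed
    then show ?case using S6.prems by simp
  next
    case (S7 x f as)
    \<comment> \<open>No argument code denotes a function of type 1, nor, in the case of
      \<open>S8_3\<close>, one of type 3.\<close>
    then show ?case by auto
  next
    case (S8_2 e1 H as g)
    then obtain c cs' where cs [simp]: "cs = c # cs'" "as = map (arg F) cs'" and H: "arg F c = V2 H"
      by auto
    let ?t = "node (list_encode [8, e1]) (list_encode (c # cs'))"
    have s: "sub v ?t i = node e1 (list_encode (Suc (Suc i) # cs))" for v i
      by (simp add: sub_def)
    \<comment> \<open>A code of a type-2 argument is 0 or 1, so \<open>H\<close> is F or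
      \<open>feferman_mu\<close>, as \<open>loc\<close> assumes.\<close>
    have l: "loc F v ?t = H (\<lambda>i. v (sub v ?t i))" for v
      using H by (auto simp: loc_def arg_def split: if_splits)
    have k: "kleene True e1 (V0 x # V2 H # map (arg F) cs') (g x)"
      and q: "Q (node e1 (list_encode (Suc (Suc x) # cs))) (g x)" for x
      using S8_2(1)[rule_format, of x] H by auto
    have "Q ?t (H g)"
    proof (rule step)
      show "terminates F ?t (H g)" using k H by (simp add: kleene.S8_2)
    next
      fix v i show "sub v ?t i = 0 \<or> (\<exists>m. terminates F (sub v ?t i) m \<and> Q (sub v ?t i) m)"
        using k q H by (auto simp: s)
    next
      fix v assume *: "\<forall>j. agrees F v (sub v ?t j)"
      have "v (sub v ?t i) = g i" for i
        using *[rule_format, of i] k[of i] H by (auto simp: s agrees_def dest: kleene_deterministic)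
      then show "loc F v ?t = H g" by (simp add: l)
    qed
    then show ?case using S8_2.prems by simp
  next
    case (S8_3 e1 M as G)
    then show ?case by auto
  next
    case (S9 m as e n)
    then obtain cs' where [simp]: "cs = Suc (Suc e) # cs'" "as = map (arg F) cs'"
      by auto
    let ?t = "node (list_encode [9, m]) (list_encode (Suc (Suc e) # cs'))"
    have m: "m \<le> length cs'" using S9(2) by simp
    have s: "sub v ?t i = (if i = 0 then node e (list_encode (take m cs')) else 0)" for v i
      using m by (simp add: sub_def sub0_def sub1_def)
    have l: "loc F v ?t = v (sub v ?t 0)" for v
      by (simp add: sub_def loc_def)
    have k: "kleene True e (map (arg F) (take m cs')) n"
      using S9(3) by (simp add: take_map)
    have q: "Q (node e (list_encode (take m cs'))) n" by (rule S9(4)) (simp_all add: take_map)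
    have "Q ?t n"
    proof (rule step)
      show "terminates F ?t n" using S9(2,3) by (simp add: kleene.S9)
    next
      fix v i show "sub v ?t i = 0 \<or> (\<exists>m. terminates F (sub v ?t i) m \<and> Q (sub v ?t i) m)"
        using k q by (auto simp: s)
    next
      fix v assume *: "\<forall>j. agrees F v (sub v ?t j)"
      then show "loc F v ?t = n"
        using *[rule_format, of 0] k by (auto simp: l s agrees_def dest: kleene_deterministic)
    qed
    then show ?case using S9.prems by simp
  qed
  then show ?thesis using assms(1) by (auto simp: terminates_def)
qed

section \<open>Guessing the graph of termination\<close>

definition val :: "(nat \<Rightarrow> nat) \<Rightarrow> nat \<Rightarrow> nat" where
  "val f t = search (\<lambda>n. f (prod_encode (t, n)) = 1)"

text \<open>Being the first mark concerns only finitely many entries of f, so a violation can be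
  witnessed on an initial segment.\<close>

definition marks :: "(nat \<Rightarrow> nat) \<Rightarrow> nat \<Rightarrow> nat \<Rightarrow> bool" where
  "marks f t n \<longleftrightarrow> f (prod_encode (t, n)) = 1 \<and> (\<forall>m. m < n \<longrightarrow> f (prod_encode (t, m)) \<noteq> 1)"

definition ok :: "((nat \<Rightarrow> nat) \<Rightarrow> nat) \<Rightarrow> (nat \<Rightarrow> nat) \<Rightarrow> nat \<Rightarrow> bool" where
  "ok F f t \<longleftrightarrow> (t \<noteq> 0 \<longrightarrow> marks f t (loc F (val f) t))"

text \<open>\<open>walk f t c s\<close> is reached from t in s steps, where the list coded by c tells which subcomputation to
  enter.\<close>

definition walk :: "(nat \<Rightarrow> nat) \<Rightarrow> nat \<Rightarrow> nat \<Rightarrow> nat \<Rightarrow> nat" where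
  "walk f t c s = rec_nat t (\<lambda>r u. sub (val f) u (nthc c r)) s"

text \<open>Quantifying over coded paths keeps this arithmetical. Well-foundedness of the tree is
  not expressed; it comes from termination.\<close>

definition sound :: "((nat \<Rightarrow> nat) \<Rightarrow> nat) \<Rightarrow> (nat \<Rightarrow> nat) \<Rightarrow> nat \<Rightarrow> bool" where
  "sound F f t \<longleftrightarrow> (\<forall>c s. ok F f (walk f t c s))"

text \<open>The walk always enters the leftmost unsound subcomputation and ends at a violated local clause.\<close>

definition bad :: "((nat \<Rightarrow> nat) \<Rightarrow> nat) \<Rightarrow> (nat \<Rightarrow> nat) \<Rightarrow> nat \<Rightarrow> nat \<Rightarrow> nat \<Rightarrow> bool" where
  "bad F f t c s \<longleftrightarrow>
     (\<forall>r. r < s \<longrightarrow> (\<forall>i. i < nthc c r \<longrightarrow> sound F f (sub (val f) (walk f t c r) i))) \<and>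
     (\<forall>i. sound F f (sub (val f) (walk f t c s) i)) \<and> \<not> ok F f (walk f t c s)"

section \<open>Walks through the tree of a guess\<close>

lemma marks_val: "marks f t n \<Longrightarrow> val f t = n"
proof -
  let ?P = "\<lambda>n. f (prod_encode (t, n)) = 1"
  assume n: "marks f t n"
  then have "?P n" by (simp add: marks_def)
  then have "search ?P \<le> n" "?P (search ?P)"
    by (rule search_le, rule search_holds)
  then show ?thesis
    using n unfolding marks_def val_def by (auto simp: le_less)
qed

lemma hdc_consc [simp]: "hdc (consc x c) = x" and tlc_consc [simp]: "tlc (consc x c) = c"
  by (simp_all add: hdc_def tlc_def consc_def)

lemma nthc_0 [simp]: "nthc c 0 = hdc c"
  by (simp add: nthc_def dropc_def)

lemma nthc_Suc: "nthc c (Suc k) = nthc (tlc c) k"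
proof -
  have "dropc (Suc k) c = dropc k (tlc c)"
    by (induction k) (simp_all add: dropc_def)
  then show ?thesis by (simp add: nthc_def)
qed

lemma walk_0 [simp]: "walk f t c 0 = t"
  by (simp add: walk_def)

text \<open>The recursion adds steps at the end; splitting off the first step instead allows
  induction from the root.\<close>

lemma walk_Suc: "walk f t c (Suc s) = walk f (sub (val f) t (hdc c)) (tlc c) s"
  by (induction s) (simp_all add: walk_def nthc_Suc)

lemma sub_0 [simp]: "sub v 0 i = 0"
  by (simp add: sub_def sub0_def sub1_def index_def hdc_def)

lemma walk_none [simp]: "walk f 0 c s = 0"
  by (induction s) (simp_all add: walk_def)

lemma sound_none: "sound F f 0"
  by (simp add: sound_def ok_def)

lemma sound_sub: "sound F f t \<Longrightarrow> sound F f (sub (val f) t i)"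
  unfolding sound_def by (metis walk_Suc hdc_consc tlc_consc)

lemma sound_ok: "sound F f t \<Longrightarrow> ok F f t"
  unfolding sound_def by (metis walk_0)

lemma sound_iff: "sound F f t \<longleftrightarrow> ok F f t \<and> (\<forall>i. sound F f (sub (val f) t i))"
proof (intro iffI conjI allI)
  assume *: "ok F f t \<and> (\<forall>i. sound F f (sub (val f) t i))"
  have "ok F f (walk f t c s)" for c s
    using * by (cases s) (auto simp: walk_Suc sound_def)
  then show "sound F f t" by (simp add: sound_def)
qed (auto intro: sound_ok sound_sub)

section \<open>Guesses compared with the true computation\<close>

lemma terminates_neq_0: "terminates F t n \<Longrightarrow> t \<noteq> 0"
  by (auto simp: terminates_def node_def)

lemma terminates_sub:
  assumes "terminates F t n" "\<forall>j<i. agrees F v (sub v t j)"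
  shows "sub v t i = 0 \<or> (\<exists>m. terminates F (sub v t i) m)"
proof -
  have "\<forall>v i. (\<forall>j<i. agrees F v (sub v t j)) \<longrightarrow> sub v t i = 0 \<or> (\<exists>m. terminates F (sub v t i) m)"
    using assms(1) by (induction rule: terminates_induct) blast
  then show ?thesis using assms(2) by blast
qed

lemma terminates_loc:
  assumes "terminates F t n" "\<forall>j. agrees F v (sub v t j)"
  shows "loc F v t = n"
proof -
  have "\<forall>v. (\<forall>j. agrees F v (sub v t j)) \<longrightarrow> loc F v t = n"
    using assms(1) by (induction rule: terminates_induct) blast
  then show ?thesis using assms(2) by blast
qed

lemma sound_val:
  assumes "terminates F t n" "sound F f t"
  shows "val f t = n"
  using assms
proof (induction rule: terminates_induct)
  case (step t n)
  \<comment> \<open>From left to right: correct values at earlier subcomputations make the next one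
    a true one, to which the hypothesis applies.\<close>
  have "agrees F (val f) (sub (val f) t i)" for i
  proof (induction i rule: less_induct)
    case (less i)
    then show ?case
      using step.IH[of i "val f"] sound_sub[OF step.prems, of i] by (auto simp: agrees_def)
  qed
  then have "loc F (val f) t = n" using step.hyps(2) by blast
  moreover have "ok F f t" "t \<noteq> 0" using step.hyps(1) step.prems by (auto dest: sound_ok terminates_neq_0)
  ultimately show ?case by (simp add: ok_def marks_val)
qed

lemma sound_agrees: "sound F f u \<Longrightarrow> u = 0 \<or> (\<exists>m. terminates F u m) \<Longrightarrow> agrees F (val f) u"
  by (auto simp: agrees_def dest: sound_val)

lemma sound_subs_agree:
  assumes "terminates F t n" "\<forall>j<i. sound F f (sub (val f) t j)"
  shows "\<forall>j<i. agrees F (val f) (sub (val f) t j)"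
  using assms(2)
proof (induction i)
  case (Suc i)
  then have "\<forall>j<i. agrees F (val f) (sub (val f) t j)" by simp
  moreover from this have "agrees F (val f) (sub (val f) t i)"
    using Suc.prems terminates_sub[OF assms(1)] by (intro sound_agrees) auto
  ultimately show ?case by (simp add: less_Suc_eq)
qed simp

lemma bad_0: "bad F f t c 0 \<longleftrightarrow> (\<forall>i. sound F f (sub (val f) t i)) \<and> \<not> ok F f t"
  by (simp add: bad_def)

lemma bad_Suc:
  "bad F f t c (Suc s) \<longleftrightarrow> (\<forall>i<hdc c. sound F f (sub (val f) t i)) \<and>
     bad F f (sub (val f) t (hdc c)) (tlc c) s"
  by (auto simp: bad_def walk_Suc nthc_Suc All_less_Suc2)

text \<open>Induction over the true tree. If all subcomputations are sound, the error is at the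
  root; otherwise the leftmost unsound one is a true subcomputation, since those before it are sound
  and so have their true values.\<close>

lemma bad_exists:
  assumes "terminates F t n" "\<not> sound F f t"
  shows "\<exists>c s. bad F f t c s"
  using assms
proof (induction rule: terminates_induct)
  case (step t n)
  show ?case
  proof (cases "\<forall>i. sound F f (sub (val f) t i)")
    case True
    then show ?thesis using step.prems sound_iff bad_0 by blast
  next
    case False
    then obtain i where i: "\<not> sound F f (sub (val f) t i)" "\<forall>j<i. sound F f (sub (val f) t j)"
      using exists_least_iff[of "\<lambda>i. \<not> sound F f (sub (val f) t i)"] by blast
    moreover have "sub (val f) t i \<noteq> 0" using i(1) sound_none by metis
    ultimately obtain c s where "bad F f (sub (val f) t i) c s"
      using step.IH[OF sound_subs_agree[OF step.hyps(1) i(2)]] by auto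
    then have "bad F f t (consc i c) (Suc s)" using i(2) by (simp add: bad_Suc)
    then show ?thesis by blast
  qed
qed

text \<open>Everything to the left of the path is sound, so the path stays among true
  subcomputations; at its end all subcomputations are sound, so \<open>loc\<close> yields the true
  value.\<close>

lemma bad_terminates:
  assumes "terminates F t n" "bad F f t c s"
  shows "terminates F (walk f t c s) (loc F (val f) (walk f t c s))"
  using assms
proof (induction s arbitrary: t n c)
  case 0
  then have "\<forall>j<i. agrees F (val f) (sub (val f) t j)" for i
    by (intro sound_subs_agree[OF 0(1)]) (simp add: bad_0)
  then have "loc F (val f) t = n"
    using terminates_loc[OF 0(1)] by blast
  then show ?case using 0(1) by simp
next
  case (Suc s)
  let ?u = "sub (val f) t (hdc c)"
  have b: "bad F f ?u (tlc c) s" and "\<forall>i<hdc c. sound F f (sub (val f) t i)"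
    using Suc.prems(2) by (auto simp: bad_Suc)
  then have "?u = 0 \<or> (\<exists>m. terminates F ?u m)"
    using terminates_sub[OF Suc.prems(1) sound_subs_agree[OF Suc.prems(1)]] by blast
  \<comment> \<open>A walk from the absent node never leaves it, and no clause is violated
    there.\<close>
  moreover have "?u \<noteq> 0"
    using b unfolding bad_def ok_def by (metis walk_none)
  ultimately show ?case using Suc.IH b by (auto simp: walk_Suc)
qed

section \<open>The functionals given to the realiser\<close>

definition error :: "((nat \<Rightarrow> nat) \<Rightarrow> nat) \<Rightarrow> nat \<Rightarrow> (nat \<Rightarrow> nat) \<Rightarrow> nat" where
  "error F t f = (let p = search (\<lambda>p. bad F f t (fst (prod_decode p)) (snd (prod_decode p)))
     in walk f t (fst (prod_decode p)) (snd (prod_decode p)))"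

text \<open>This is \<open>G\<^sub>k\<^sub>,\<^sub>j\<close>. The \<open>Suc\<close> puts the entry
  for the true value at the erroneous node into the segment; the entries for smaller values have
  smaller codes and lie in it too.\<close>

definition modulus :: "((nat \<Rightarrow> nat) \<Rightarrow> nat) \<Rightarrow> nat \<Rightarrow> nat \<Rightarrow> nat \<Rightarrow> (nat \<Rightarrow> nat) \<Rightarrow> nat" where
  "modulus F t k j f =
     (if sound F f t then if val f t = k then j else 0
      else Suc (prod_encode (error F t f, loc F (val f) (error F t f))))"

lemma error_terminates:
  assumes "terminates F t n" "\<not> sound F f t"
  shows "terminates F (error F t f) (loc F (val f) (error F t f))" "\<not> ok F f (error F t f)"
proof -
  let ?P = "\<lambda>p. bad F f t (fst (prod_decode p)) (snd (prod_decode p))"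
  obtain c s where "bad F f t c s" using bad_exists[OF assms] by blast
  then have "?P (prod_encode (c, s))" by simp
  then have "?P (search ?P)" by (rule search_holds)
  then show "terminates F (error F t f) (loc F (val f) (error F t f))" "\<not> ok F f (error F t f)"
    using bad_terminates[OF assms(1)] by (auto simp: error_def Let_def bad_def)
qed

definition graph :: "((nat \<Rightarrow> nat) \<Rightarrow> nat) \<Rightarrow> nat \<Rightarrow> nat" where
  "graph F x = (if terminates F (fst (prod_decode x)) (snd (prod_decode x)) then 1 else 0)"

lemma prod_encode_less: "m < n \<Longrightarrow> prod_encode (t, m) < prod_encode (t, n)"
proof (induction n)
  case (Suc n)
  have "prod_encode (t, n) < prod_encode (t, Suc n)" by (simp add: prod_encode_def)
  then show ?case using Suc by (auto simp: less_Suc_eq)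
qed simp

text \<open>The graph marks exactly the true value at the erroneous node. If f shared these entries,
  its first mark there would be that value and the local clause would hold.\<close>

lemma graph_avoids_unsound:
  assumes "terminates F t n" "\<not> sound F f t"
  shows "\<not> ext_seg f (modulus F t k j f) (graph F)"
proof
  let ?u = "error F t f" and ?m = "loc F (val f) (error F t f)"
  assume "ext_seg f (modulus F t k j f) (graph F)"
  then have eq: "f (prod_encode (?u, m)) = graph F (prod_encode (?u, m))" if "m \<le> ?m" for m
    using that assms(2) prod_encode_less[of m ?m ?u]
    by (auto simp: ext_seg_def modulus_def le_less)
  have "terminates F ?u ?m" "\<not> ok F f ?u" using error_terminates[OF assms] .
  then have "marks f ?u ?m"
    unfolding marks_def by (auto simp: eq graph_def dest: terminates_deterministic)
  then show False using \<open>\<not> ok F f ?u\<close> by (simp add: ok_def)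
qed

lemma realiser_modulus_ge:
  assumes "pincherle_realiser M" "terminates F t n"
  shows "j \<le> M (modulus F t n j)"
proof -
  \<comment> \<open>At a sound f the bound is j because f has the value n at t; at an unsound f the
    neighbourhood misses the graph, so only the value 0 has to be bounded.\<close>
  let ?H = "\<lambda>g. if g = graph F then j else 0"
  have "LOC ?H (modulus F t n j)"
    unfolding LOC_def
  proof (intro ballI impI)
    fix f g assume *: "ext_seg f (modulus F t n j f) g"
    show "?H g \<le> modulus F t n j f"
    proof (cases "sound F f t")
      case True
      then show ?thesis using sound_val[OF assms(2)] by (simp add: modulus_def)
    next
      case False
      then show ?thesis using * graph_avoids_unsound[OF assms(2)] by auto
    qed
  qed
  moreover have "graph F \<in> cantor" by (simp add: cantor_def graph_def)
  ultimately have "?H (graph F) \<le> M (modulus F t n j)"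
    using assms(1) unfolding pincherle_realiser_def by blast
  then show ?thesis by simp
qed

text \<open>A sound guess has the value n at t, so the branch returning j is never taken.\<close>

lemma modulus_wrong_value:
  assumes "terminates F t n" "k \<noteq> n"
  shows "modulus F t k j = modulus F t k 0"
  using sound_val[OF assms(1)] assms(2) by (auto simp: modulus_def fun_eq_iff)

definition extension :: "((nat \<Rightarrow> nat) \<Rightarrow> nat) \<Rightarrow> (((nat \<Rightarrow> nat) \<Rightarrow> nat) \<Rightarrow> nat) \<Rightarrow> nat \<Rightarrow> nat" where
  "extension F M t = fst (prod_decode (search (\<lambda>p.
     M (\<lambda>f. modulus F t (fst (prod_decode p)) (snd (prod_decode p)) f) \<noteq>
     M (\<lambda>f. modulus F t (fst (prod_decode p)) 0 f))))"

lemma extension_eq: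
  assumes "pincherle_realiser M" "terminates F t n"
  shows "extension F M t = n"
proof -
  define P where "P p \<longleftrightarrow> M (modulus F t (fst (prod_decode p)) (snd (prod_decode p))) \<noteq>
     M (modulus F t (fst (prod_decode p)) 0)" for p
  \<comment> \<open>Choosing j above \<open>M (modulus F t n 0)\<close> forces the two values of M
    apart.\<close>
  have "P (prod_encode (n, Suc (M (modulus F t n 0))))"
    using realiser_modulus_ge[OF assms, of "Suc (M (modulus F t n 0))"] by (auto simp: P_def)
  then have "P (search P)" by (rule search_holds)
  then have "fst (prod_decode (search P)) = n"
    using modulus_wrong_value[OF assms(2)] unfolding P_def[of "search P"] by metis
  then show ?thesis by (simp add: extension_def P_def[abs_def])
qed

section \<open>Primitive recursiveness of the extension\<close>

lemma PR_node: "PR env e \<Longrightarrow> PR env c \<Longrightarrow> PR env (\<lambda>p. node (e p) (c p))"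
  unfolding node_def by (intro PR_prod_encode PR_Suc)

lemma PR_index: "PR env t \<Longrightarrow> PR env (\<lambda>p. index (t p))"
  unfolding index_def by (intro PR_fst_prod_decode PR_pred)

lemma PR_args: "PR env t \<Longrightarrow> PR env (\<lambda>p. args (t p))"
  unfolding args_def by (intro PR_snd_prod_decode PR_pred)

lemmas PR_code_intros = PR_node PR_index PR_args PR_hdc PR_tlc PR_consc PR_nthc PR_takec PR_swapc
  PR_prod_encode PR_fst_prod_decode PR_snd_prod_decode

lemma PR_val:
  assumes f: "has env (\<lambda>p. V1 (f p))" and t: "PR env t"
  shows "PR env (\<lambda>p. val (f p) (t p))"
  unfolding val_def
  by (intro PR_app1[OF has_push[OF f]] PR_intros PR_code_intros t PR_wf_env[OF t])

lemma PR_sub0: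
  assumes t: "PR env t"
  shows "PR env (\<lambda>p. sub0 (t p))"
  unfolding sub0_def Let_def
  by (intro PR_if PRP_eq PR_diff PR_const PR_code_intros t PR_wf_env[OF t])

lemma PR_sub1:
  assumes f: "has env (\<lambda>p. V1 (f p))" and t: "PR env t"
  shows "PR env (\<lambda>p. sub1 (val (f p)) (t p))"
  unfolding sub1_def Let_def
  by (intro PR_if PRP_eq PRP_conj PRP_not PR_add PR_diff PR_const PR_code_intros PR_val[OF f]
      PR_sub0 t PR_wf_env[OF t])

lemma PR_sub:
  assumes f: "has env (\<lambda>p. V1 (f p))" and t: "PR env t" and i: "PR env i"
  shows "PR env (\<lambda>p. sub (val (f p)) (t p) (i p))"
  unfolding sub_def
  by (intro PR_if PRP_eq PR_add PR_const PR_code_intros PR_sub0 PR_sub1 f t i PR_wf_env[OF t])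

lemma PR_loc:
  assumes f: "has env (\<lambda>p. V1 (f p))" and F: "has env (\<lambda>p. V2 (F p))" and t: "PR env t"
  shows "PR env (\<lambda>p. loc (F p) (val (f p)) (t p))"
proof -
  note wf = PR_wf_env[OF t]
  \<comment> \<open>The function handed to the oracle, the same for F and
    \<open>feferman_mu\<close>.\<close>
  have vs: "PR (push V0 env) (\<lambda>q. val (f (snd q)) (sub (val (f (snd q))) (t (snd q)) (fst q)))"
    by (intro PR_val PR_sub has_push f PR_push_head PR_push t wf)
  show ?thesis
    unfolding loc_def Let_def
    by (intro PR_if PRP_eq PRP_conj PRP_disj PRP_not PR_diff PR_const PR_code_intros PR_val[OF f]
        PR_sub0 PR_sub1 f t wf PR_app2[OF F vs] PR_mu[OF vs])
qed

lemma PRP_ok: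
  assumes f: "has env (\<lambda>p. V1 (f p))" and F: "has env (\<lambda>p. V2 (F p))" and t: "PR env t"
  shows "PRP env (\<lambda>p. ok (F p) (f p) (t p))"
  unfolding ok_def marks_def
  by (intro PR_app1[OF f] PR_app1[OF has_push[OF f]] PRP_imp PRP_not PRP_eq PRP_conj PRP_all PRP_less
      PR_push PR_push_head PR_const PR_prod_encode PR_loc f F t wf_env_push PR_wf_env[OF t])

lemma PR_walk:
  assumes f: "has env (\<lambda>p. V1 (f p))" and t: "PR env t" and c: "PR env c" and s: "PR env s"
  shows "PR env (\<lambda>p. walk (f p) (t p) (c p) (s p))"
  unfolding walk_def
  by (intro PR_rec PR_sub has_push f PR_nthc PR_push PR_push_head t c s wf_env_push PR_wf_env[OF t])

lemma PRP_sound: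
  assumes f: "has env (\<lambda>p. V1 (f p))" and F: "has env (\<lambda>p. V2 (F p))" and t: "PR env t"
  shows "PRP env (\<lambda>p. sound (F p) (f p) (t p))"
  unfolding sound_def
  by (intro PRP_all PRP_ok PR_walk has_push f F PR_push PR_push_head t wf_env_push PR_wf_env[OF t])

lemma PRP_bad:
  assumes f: "has env (\<lambda>p. V1 (f p))" and F: "has env (\<lambda>p. V2 (F p))"
    and t: "PR env t" and c: "PR env c" and s: "PR env s"
  shows "PRP env (\<lambda>p. bad (F p) (f p) (t p) (c p) (s p))"
  unfolding bad_def
  by (intro PRP_conj PRP_all PRP_imp PRP_not PRP_less PRP_sound PRP_ok PR_sub PR_walk PR_nthc
      has_push f F PR_push PR_push_head t c s wf_env_push PR_wf_env[OF t])

lemma PR_error: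
  assumes f: "has env (\<lambda>p. V1 (f p))" and F: "has env (\<lambda>p. V2 (F p))" and t: "PR env t"
  shows "PR env (\<lambda>p. error (F p) (t p) (f p))"
  unfolding error_def Let_def
  by (intro PR_walk PR_fst_prod_decode PR_snd_prod_decode PR_search PRP_bad
      has_push f F PR_push PR_push_head t wf_env_push PR_wf_env[OF t])

lemma PR_modulus:
  assumes f: "has env (\<lambda>p. V1 (f p))" and F: "has env (\<lambda>p. V2 (F p))"
    and t: "PR env t" and k: "PR env k" and j: "PR env j"
  shows "PR env (\<lambda>p. modulus (F p) (t p) (k p) (j p) (f p))"
  unfolding modulus_def
  by (intro PR_if PRP_sound PRP_eq PR_val PR_const PR_Suc PR_prod_encode PR_error PR_loc
      f F t k j PR_wf_env[OF t])

text \<open>M is applied by S8 with the guess f as a new type-1 argument; all else is search and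
  arithmetic, total for every F and M.\<close>

lemma PR_extension:
  assumes F: "has env (\<lambda>p. V2 (F p))" and M: "has env (\<lambda>p. V3 (M p))" and t: "PR env t"
  shows "PR env (\<lambda>p. extension (F p) (M p) (t p))"
  unfolding extension_def
  by (intro PR_fst_prod_decode PR_snd_prod_decode PR_search PRP_not PRP_eq PR_app3[OF has_push[OF M]]
      PR_modulus has_push has_push_head F PR_push PR_push_head PR_const t wf_env_push PR_wf_env[OF t])

theorem theorem3p3:
  fixes e0 :: nat
  shows "\<exists>d. \<forall>M. pincherle_realiser M \<longrightarrow>
           (\<forall>F. \<exists>n. prim_rec_comp d [V2 F, V3 M, V2 feferman_mu] n) \<and>
           (\<forall>F n. kleene_comp e0 [V2 F, V2 feferman_mu] n \<longrightarrow>
                  prim_rec_comp d [V2 F, V3 M, V2 feferman_mu] n)"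
proof -
  let ?env = "\<lambda>p. [V2 (fst p), V3 (snd p), V2 feferman_mu]"
  \<comment> \<open>The codes 0 and 1 stand for the arguments F and
    \<open>feferman_mu\<close>.\<close>
  let ?t = "node e0 (list_encode [0, 1])"
  have "wf_env ?env"
    unfolding wf_env_def by (auto intro!: exI[of _ 2])
  moreover have "has ?env (\<lambda>p. V2 (fst p))" "has ?env (\<lambda>p. V3 (snd p))"
    unfolding has_def by (rule exI[of _ 0], simp) (rule exI[of _ 1], simp)
  ultimately have "PR ?env (\<lambda>p. extension (fst p) (snd p) ?t)"
    by (intro PR_extension PR_const)
  \<comment> \<open>The index is fixed before F and M, and it computes a value even where
    \<open>e0\<close> diverges.\<close>
  then obtain d where "\<forall>p. prim_rec_comp d (?env p) (extension (fst p) (snd p) ?t)"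
    unfolding PR_def by blast
  then have d: "prim_rec_comp d [V2 F, V3 M, V2 feferman_mu] (extension F M ?t)" for F M
    by (metis fst_conv snd_conv)
  have "terminates F ?t n" if "kleene_comp e0 [V2 F, V2 feferman_mu] n" for F n
    using that by (simp add: arg_def)
  then show ?thesis
    using d extension_eq by metis
qed

end
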